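(* Let $(X,G,\Phi)$ be an equicontinuous Cantor minimal system with an associated group chain $\{G_i\}_{i\ge0}$ at $x\in X$, and let $\mathcal{D}_x$ be the discriminant group at $x$. Then $(X,G,\Phi)$ is homogeneous if and only if $\mathcal{D}_x$ is trivial.
   Context: An equicontinuous Cantor minimal system $(X,G,\Phi)$ consists of a Cantor set $X$, a finitely generated infinite group $G$, and an action $\Phi\colon G\times X\to X$ by homeomorphisms (write $g\cdot x=\Phi(g)(x)$) which is minimal (every orbit is dense) and equicontinuous: for a metric $d$ on $X$, for all $\varepsilon>0$ there is $\delta>0$ such that $d(u,v)<\delta$ implies $d(g\cdot u,g\cdot v)<\varepsilon$ for all $u,v\in X$, $g\in G$. $\mathrm{Aut}(X,G,\Phi)$ is the group of homeomorphisms $h\colon X\to X$ with $h(g\cdot y)=g\cdot h(y)$ for all $g\in G$, $y\in X$. The action is homogeneous if $\mathrm{Aut}(X,G,\Phi)$ acts transitively on $X$. A group chain in $G$ is a properly descending chain $G=G_0\supset G_1\supset G_2\supset\cdots$ of subgroups of finite index. A group chain associated to $(X,G,\Phi)$ at the basepoint $x$ is obtained from clopen sets $X=V_0\supset V_1\supset\cdots$ with $\bigcap_i V_i=\{x\}$ such that each $\mathcal{P}_i=\{g\cdot V_i\}_{g\in G}$ is a finite partition of $X$ and $\mathrm{diam}(g\cdot V_i)<2^{-i}$ for all $g\in G$, $i\ge1$, by setting $G_i=\{g\in G\mid g\cdot V_i=V_i\}$. With $C_i=\bigcap_{g\in G}gG_ig^{-1}$, the discriminant group at $x$ is the profinite group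 $\mathcal{D}_x=\varprojlim\{G_{i+1}/C_{i+1}\to G_i/C_i\}$, with bonding maps induced by inclusion of cosets. *)

theory Defs
  imports "HOL-Analysis.Analysis" "HOL-Algebra.Group_Action" "HOL-Algebra.Product_Groups"
begin

definition cantor_set :: "'a::topological_space set \<Rightarrow> bool" where
  "cantor_set X \<longleftrightarrow>
     top_of_set X homeomorphic_space
       product_topology (\<lambda>_. discrete_topology (UNIV :: bool set)) (UNIV :: nat set)"

definition finitely_generated_group :: "('g, 'c) monoid_scheme \<Rightarrow> bool" where
  "finitely_generated_group G \<longleftrightarrow>
     group G \<and> (\<exists>S. finite S \<and> S \<subseteq> carrier G \<and> generate G S = carrier G)"

text \<open>
  The metric on \<open>X\<close> is the one it inherits from the ambient metric space. In \<open>group_action\<close> the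
  maps \<open>\<phi> g\<close> are bijections of \<open>X\<close> that take the value \<open>undefined\<close> outside \<open>X\<close>.
\<close>

locale equicontinuous_cantor_minimal_system =
  group_action G X \<phi>
  for G :: "('g, 'c) monoid_scheme" (structure)
    and X :: "'a::metric_space set"
    and \<phi> :: "'g \<Rightarrow> 'a \<Rightarrow> 'a" +
  assumes cantor: "cantor_set X"
    and finitely_generated: "finitely_generated_group G"
    and infinite_group: "infinite (carrier G)"
    and homeo: "\<And>g. g \<in> carrier G \<Longrightarrow> homeomorphic_map (top_of_set X) (top_of_set X) (\<phi> g)"
    and minimal: "\<And>y. y \<in> X \<Longrightarrow> X \<subseteq> closure (orbit G \<phi> y)"
    and equicontinuous:
      "\<And>\<epsilon>::real. \<epsilon> > 0 \<Longrightarrow> \<exists>\<delta>>0. \<forall>u\<in>X. \<forall>v\<in>X. \<forall>g\<in>carrier G.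
         dist u v < \<delta> \<longrightarrow> dist (\<phi> g u) (\<phi> g v) < \<epsilon>"

definition system_Aut ::
  "('g, 'c) monoid_scheme \<Rightarrow> 'a::topological_space set \<Rightarrow> ('g \<Rightarrow> 'a \<Rightarrow> 'a) \<Rightarrow> ('a \<Rightarrow> 'a) monoid"
  where
  "system_Aut G X \<phi> = BijGroup X
     \<lparr>carrier := {h \<in> Bij X. homeomorphic_map (top_of_set X) (top_of_set X) h \<and>
                    (\<forall>g\<in>carrier G. \<forall>y\<in>X. h (\<phi> g y) = \<phi> g (h y))}\<rparr>"

definition homogeneous_system ::
  "('g, 'c) monoid_scheme \<Rightarrow> 'a::topological_space set \<Rightarrow> ('g \<Rightarrow> 'a \<Rightarrow> 'a) \<Rightarrow> bool"
  where
  "homogeneous_system G X \<phi> \<longleftrightarrow> transitive_action (system_Aut G X \<phi>) X (\<lambda>h. h)"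

definition group_chain :: "('g, 'c) monoid_scheme \<Rightarrow> (nat \<Rightarrow> 'g set) \<Rightarrow> bool" where
  "group_chain G Gs \<longleftrightarrow>
     Gs 0 = carrier G \<and>
     (\<forall>i. subgroup (Gs i) G \<and> finite (rcosets\<^bsub>G\<^esub> (Gs i)) \<and> Gs (Suc i) \<subset> Gs i)"

text \<open>
  The sets \<open>V i\<close> are only asked to be nested; that they decrease properly follows from the
  properness of the group chain.
\<close>

definition associated_group_chain ::
  "('g, 'c) monoid_scheme \<Rightarrow> 'a::metric_space set \<Rightarrow> ('g \<Rightarrow> 'a \<Rightarrow> 'a) \<Rightarrow> 'a \<Rightarrow> (nat \<Rightarrow> 'g set) \<Rightarrow> bool"
  where
  "associated_group_chain G X \<phi> x Gs \<longleftrightarrow>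
     group_chain G Gs \<and>
     (\<exists>V. V 0 = X \<and> decseq V \<and> (\<Inter>i. V i) = {x} \<and>
        (\<forall>i. openin (top_of_set X) (V i) \<and> closedin (top_of_set X) (V i)) \<and>
        (\<forall>i. finite {\<phi> g ` V i | g. g \<in> carrier G} \<and>
             partition_on X {\<phi> g ` V i | g. g \<in> carrier G}) \<and>
        (\<forall>i\<ge>1. \<forall>g\<in>carrier G. diameter (\<phi> g ` V i) < 1 / 2 ^ i) \<and>
        (\<forall>i. Gs i = {g \<in> carrier G. \<phi> g ` V i = V i}))"

definition normal_core :: "('g, 'c) monoid_scheme \<Rightarrow> 'g set \<Rightarrow> 'g set" where
  "normal_core G H = (\<Inter>g\<in>carrier G. g <#\<^bsub>G\<^esub> H #>\<^bsub>G\<^esub> inv\<^bsub>G\<^esub> g)"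

text \<open>The inverse limit of a sequence of groups with bonding maps \<open>f i\<close> from \<open>K (Suc i)\<close> to \<open>K i\<close>.\<close>

definition inverse_limit_group ::
  "(nat \<Rightarrow> ('b, 'd) monoid_scheme) \<Rightarrow> (nat \<Rightarrow> 'b \<Rightarrow> 'b) \<Rightarrow> (nat \<Rightarrow> 'b) monoid" where
  "inverse_limit_group K f = product_group UNIV K
     \<lparr>carrier := {\<xi> \<in> carrier (product_group UNIV K). \<forall>i. f i (\<xi> (Suc i)) = \<xi> i}\<rparr>"

text \<open>
  If \<open>A\<close> is a coset of \<open>C (Suc i)\<close>, then \<open>C i <#> A\<close> is the coset of \<open>C i\<close> that contains it, so the
  bonding maps below are the ones induced by inclusion of cosets. The profinite topology plays no
  role for triviality and is not recorded.
\<close>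

definition discriminant_group ::
  "('g, 'c) monoid_scheme \<Rightarrow> (nat \<Rightarrow> 'g set) \<Rightarrow> (nat \<Rightarrow> 'g set) monoid" where
  "discriminant_group G Gs =
     (let C = (\<lambda>i. normal_core G (Gs i))
      in inverse_limit_group (\<lambda>i. G\<lparr>carrier := Gs i\<rparr> Mod C i) (\<lambda>i A. C i <#>\<^bsub>G\<^esub> A))"

end

theory Submission
  imports Defs
begin

text \<open>
  The normal core \<open>C i\<close> of \<open>Gs i\<close> consists of the elements that map every translate of \<open>V i\<close> to itself.
  If an automorphism takes \<open>x\<close> to a point \<open>p\<close> of such a translate \<open>A\<close> and \<open>g j \<in> Gs j\<close>, then
  \<open>\<phi> (g j) x\<close> converges to \<open>x\<close>, hence \<open>\<phi> (g j) p\<close> to \<open>p\<close>, so \<open>g j\<close> fixes \<open>A\<close> for large \<open>j\<close>.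
  With automorphisms reaching every translate, a sequence representing an element of the discriminant
  group therefore ends up in each \<open>C i\<close>, and the element is trivial.

  Conversely, triviality of the discriminant group yields, by compactness, for each \<open>i\<close> some \<open>j\<close>
  with \<open>Gs j \<subseteq> C i\<close>. Then for any \<open>y\<close> and \<open>z\<close> the map \<open>\<phi> g y \<mapsto> \<phi> g z\<close> between orbits is well defined and
  uniformly continuous in both directions, and it extends to an automorphism taking \<open>y\<close> to \<open>z\<close>.
\<close>

section \<open>Finite images, conjugates and the automorphism group\<close>

lemma finite_image_factor:
  assumes "finite (F ` A)" and "\<And>a b. a \<in> A \<Longrightarrow> b \<in> A \<Longrightarrow> F a = F b \<Longrightarrow> f a = f b"
  shows "finite (f ` A)"
proof -
  have "f ` A \<subseteq> (\<lambda>y. f (SOME a. a \<in> A \<and> F a = y)) ` F ` A"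
  proof
    fix z assume "z \<in> f ` A"
    then obtain a where a: "a \<in> A" "z = f a" by auto
    let ?b = "SOME b. b \<in> A \<and> F b = F a"
    have "?b \<in> A \<and> F ?b = F a" using a someI[of "\<lambda>b. b \<in> A \<and> F b = F a" a] by simp
    then have "z = f ?b" using assms(2) a by metis
    then show "z \<in> (\<lambda>y. f (SOME a. a \<in> A \<and> F a = y)) ` F ` A" using a(1) by blast
  qed
  then show ?thesis using assms(1) finite_surj by blast
qed

lemma (in group) in_conjugate_iff:
  assumes "g \<in> carrier G" "H \<subseteq> carrier G"
  shows "c \<in> g <# H #> inv g \<longleftrightarrow> c \<in> carrier G \<and> inv g \<otimes> c \<otimes> g \<in> H"
proof
  assume "c \<in> g <# H #> inv g"
  then obtain h where h: "h \<in> H" "c = g \<otimes> h \<otimes> inv g"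
    unfolding l_coset_def r_coset_def by blast
  moreover have hc: "h \<in> carrier G" using h assms by blast
  moreover have "inv g \<otimes> c \<otimes> g = inv g \<otimes> (g \<otimes> h) \<otimes> (inv g \<otimes> g)"
    using h assms hc by (simp only: m_assoc m_closed inv_closed)
  moreover have "\<dots> = h" using assms hc m_assoc[of "inv g" g h] by simp
  ultimately show "c \<in> carrier G \<and> inv g \<otimes> c \<otimes> g \<in> H" using assms by simp
next
  assume c: "c \<in> carrier G \<and> inv g \<otimes> c \<otimes> g \<in> H"
  have "g \<otimes> (inv g \<otimes> c \<otimes> g) \<otimes> inv g = (g \<otimes> inv g) \<otimes> c \<otimes> (g \<otimes> inv g)"
    using c assms by (simp only: m_assoc m_closed inv_closed)
  then have "c = g \<otimes> (inv g \<otimes> c \<otimes> g) \<otimes> inv g" using c assms by simp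
  then show "c \<in> g <# H #> inv g" using c unfolding l_coset_def r_coset_def by blast
qed

text \<open>\<open>transitive_action\<close> includes the axioms of a group action, so homogeneity
  asks for more than transitivity. The automorphisms form a subgroup of \<open>BijGroup X\<close>,
  and its inclusion is the action.\<close>

lemma group_action_system_Aut:
  assumes "group_action G X \<phi>"
  shows "group_action (system_Aut G X \<phi>) X (\<lambda>h. h)"
proof -
  interpret group_action G X \<phi> by fact
  interpret B: group "BijGroup X" by (rule group_BijGroup)
  let ?A = "{h \<in> Bij X. homeomorphic_map (top_of_set X) (top_of_set X) h \<and>
                    (\<forall>g\<in>carrier G. \<forall>y\<in>X. h (\<phi> g y) = \<phi> g (h y))}"
  have sub: "subgroup ?A (BijGroup X)"
  proof (rule B.subgroupI)
    show "?A \<subseteq> carrier (BijGroup X)" by (auto simp: BijGroup_def)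
    have "homeomorphic_map (top_of_set X) (top_of_set X) (\<lambda>x\<in>X. x)"
      using homeomorphic_map_eq[OF homeomorphic_map_id[THEN iffD2, OF refl], of "top_of_set X" "\<lambda>x\<in>X. x"]
      by simp
    then have "(\<lambda>x\<in>X. x) \<in> ?A"
      using id_Bij element_image by auto
    then show "?A \<noteq> {}" by blast
  next
    fix h assume h: "h \<in> ?A"
    then have hX: "bij_betw h X X" by (auto simp: Bij_def)
    \<comment> \<open>Elements of \<open>Bij X\<close> are \<open>undefined\<close> outside
      \<open>X\<close>, so the inverse has to be restricted to \<open>X\<close>.\<close>
    let ?k = "\<lambda>x\<in>X. inv_into X h x"
    have maps: "homeomorphic_maps (top_of_set X) (top_of_set X) h ?k"
    proof -
      obtain k where k: "homeomorphic_maps (top_of_set X) (top_of_set X) h k"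
        using h homeomorphic_map_maps by blast
      have "?k y = k y" if "y \<in> X" for y
        using k that hX
        by (auto simp: homeomorphic_maps_def bij_betw_def continuous_map_def Pi_iff
            intro!: inv_into_f_eq)
      then show ?thesis
        using k homeomorphic_maps_eq[OF k, of h ?k] by simp
    qed
    have kB: "?k \<in> Bij X" using h restrict_inv_into_Bij by auto
    have "?k (\<phi> g y) = \<phi> g (?k y)" if "g \<in> carrier G" "y \<in> X" for g y
    proof -
      have ky: "?k y \<in> X" "h (?k y) = y"
        using that hX by (auto simp: bij_betw_def f_inv_into_f inv_into_into)
      \<comment> \<open>Injectivity of \<open>h\<close> reduces equivariance of the inverse to that
        of \<open>h\<close>.\<close>
      have "h (\<phi> g (?k y)) = \<phi> g y" using h ky that by auto
      moreover have "\<phi> g (?k y) \<in> X" "\<phi> g y \<in> X" using element_image that ky by blast+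
      ultimately show ?thesis using hX
        by (simp add: bij_betw_def inv_into_f_eq)
    qed
    then have "?k \<in> ?A"
      using kB homeomorphic_maps_sym[THEN iffD1, OF maps] homeomorphic_map_maps by blast
    then show "inv\<^bsub>BijGroup X\<^esub> h \<in> ?A" using h by (simp add: inv_BijGroup)
  next
    fix h k assume h: "h \<in> ?A" and k: "k \<in> ?A"
    have kX: "k y \<in> X" if "y \<in> X" for y using k that Bij_imp_funcset by auto
    have "homeomorphic_map (top_of_set X) (top_of_set X) (compose X h k)"
      using homeomorphic_map_eq[OF homeomorphic_map_compose, of "top_of_set X" "top_of_set X" k
          "top_of_set X" h "compose X h k"] h k
      by (auto simp: compose_def)
    moreover have "compose X h k (\<phi> g y) = \<phi> g (compose X h k y)"
      if "g \<in> carrier G" "y \<in> X" for g y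
      using that h k kX element_image[OF that(1)] by (auto simp: compose_def)
    ultimately have "compose X h k \<in> ?A" using h k compose_Bij by auto
    then show "h \<otimes>\<^bsub>BijGroup X\<^esub> k \<in> ?A" using h k by (simp add: BijGroup_def)
  qed
  have "group (system_Aut G X \<phi>)"
    using B.subgroup_imp_group[OF sub] by (simp add: system_Aut_def)
  moreover have "(\<lambda>h. h) \<in> hom (system_Aut G X \<phi>) (BijGroup X)"
    using subgroup.subset[OF sub] by (auto simp: hom_def system_Aut_def)
  ultimately show ?thesis
    by (simp add: group_action_def group_hom_def group_hom_axioms_def B.is_group)
qed

section \<open>Translates of the sets \<open>V i\<close>\<close>

locale associated_chain = equicontinuous_cantor_minimal_system G X \<phi>
  for G :: "('g, 'c) monoid_scheme" (structure)
    and X :: "'a::metric_space set"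
    and \<phi> :: "'g \<Rightarrow> 'a \<Rightarrow> 'a" +
  fixes x :: 'a and Gs :: "nat \<Rightarrow> 'g set" and V :: "nat \<Rightarrow> 'a set"
  assumes chain: "group_chain G Gs"
    and V_decseq: "decseq V"
    and V_Inter: "(\<Inter>i. V i) = {x}"
    and V_open: "\<And>i. openin (top_of_set X) (V i)"
    and blocks_finite: "\<And>i. finite {\<phi> g ` V i | g. g \<in> carrier G}"
    and blocks_partition: "\<And>i. partition_on X {\<phi> g ` V i | g. g \<in> carrier G}"
    and blocks_diameter: "\<And>i g. i \<ge> 1 \<Longrightarrow> g \<in> carrier G \<Longrightarrow> diameter (\<phi> g ` V i) < 1 / 2 ^ i"
    and Gs_eq: "\<And>i. Gs i = {g \<in> carrier G. \<phi> g ` V i = V i}"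
begin

sublocale group G
  using group_hom group_hom.axioms(1) by auto

definition blocks :: "nat \<Rightarrow> 'a set set" where
  "blocks i = {\<phi> g ` V i | g. g \<in> carrier G}"

text \<open>For each level a \<open>G\<close>-invariant equivalence relation on \<open>X\<close>,
  which replaces the metric as the measure of closeness. \<open>same_block_nbhd\<close> and
  \<open>ex_small_level\<close> translate between the two.\<close>

definition same_block :: "nat \<Rightarrow> 'a \<Rightarrow> 'a \<Rightarrow> bool" where
  "same_block i u v \<longleftrightarrow> (\<exists>A\<in>blocks i. u \<in> A \<and> v \<in> A)"

abbreviation C :: "nat \<Rightarrow> 'g set" where
  "C i \<equiv> normal_core G (Gs i)"

lemma phi_closed [simp]: "g \<in> carrier G \<Longrightarrow> u \<in> X \<Longrightarrow> \<phi> g u \<in> X"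
  using element_image by blast

lemma phi_one: "u \<in> X \<Longrightarrow> \<phi> \<one> u = u"
  using id_eq_one by (metis restrict_apply')

lemma phi_inv: "g \<in> carrier G \<Longrightarrow> u \<in> X \<Longrightarrow> \<phi> (inv g) (\<phi> g u) = u"
  using orbit_sym_aux by blast

lemma V_subset: "V i \<subseteq> X"
  using V_open openin_imp_subset by blast

lemma x_in_V: "x \<in> V i"
  using V_Inter by auto

lemma x_in_X: "x \<in> X"
  using V_subset x_in_V by blast

lemma image_mult:
  assumes "A \<subseteq> X" "g \<in> carrier G" "h \<in> carrier G"
  shows "\<phi> (g \<otimes> h) ` A = \<phi> g ` \<phi> h ` A"
  using assms composition_rule by (force simp: image_image intro!: image_cong)

lemma image_one: "A \<subseteq> X \<Longrightarrow> \<phi> \<one> ` A = A"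
  using phi_one by force

lemma image_inv:
  assumes "A \<subseteq> X" "g \<in> carrier G"
  shows "\<phi> (inv g) ` \<phi> g ` A = A"
  using assms image_mult[of A "inv g" g] image_one by simp

lemma V_in_blocks: "V i \<in> blocks i"
proof -
  have "\<phi> \<one> ` V i \<in> blocks i" unfolding blocks_def using one_closed by blast
  then show ?thesis by (simp only: image_one[OF V_subset])
qed

lemma blocks_subset: "A \<in> blocks i \<Longrightarrow> A \<subseteq> X"
  using blocks_partition[of i] unfolding blocks_def partition_on_def by blast

lemma image_blocks: "g \<in> carrier G \<Longrightarrow> A \<in> blocks i \<Longrightarrow> \<phi> g ` A \<in> blocks i"
  unfolding blocks_def using image_mult[OF V_subset] m_closed by (smt (verit) mem_Collect_eq)

lemma blocks_cover: "u \<in> X \<Longrightarrow> \<exists>A\<in>blocks i. u \<in> A"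
  using blocks_partition[of i] unfolding blocks_def partition_on_def by blast

lemma blocks_disjoint: "A \<in> blocks i \<Longrightarrow> B \<in> blocks i \<Longrightarrow> u \<in> A \<Longrightarrow> u \<in> B \<Longrightarrow> A = B"
  using partition_onD2[OF blocks_partition[of i, folded blocks_def]] by (auto dest: disjointD)

lemma blocks_open:
  assumes "A \<in> blocks i" shows "openin (top_of_set X) A"
  using assms homeomorphic_map_openness_eq[OF homeo] V_open V_subset
  unfolding blocks_def by auto

section \<open>The chain groups, their normal cores and cosets\<close>

lemma in_Gs_iff: "g \<in> Gs i \<longleftrightarrow> g \<in> carrier G \<and> \<phi> g ` V i = V i"
  by (simp add: Gs_eq)

lemma Gs_subgroup: "subgroup (Gs i) G"
  using chain by (simp add: group_chain_def)

lemma Gs_antimono: "i \<le> j \<Longrightarrow> Gs j \<subseteq> Gs i"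
  using chain lift_Suc_antimono_le[of Gs] unfolding group_chain_def by blast

text \<open>Conjugating a stabilizer by \<open>k\<close> gives the stabilizer of the translate by
  \<open>k\<close>. This turns the core, an intersection of conjugates, into the kernel of the
  action on \<open>blocks i\<close>.\<close>

lemma conjugate_in_Gs_iff:
  assumes "c \<in> carrier G" "k \<in> carrier G"
  shows "inv k \<otimes> c \<otimes> k \<in> Gs i \<longleftrightarrow> \<phi> c ` \<phi> k ` V i = \<phi> k ` V i"
proof -
  let ?W = "\<phi> c ` \<phi> k ` V i"
  have kV: "\<phi> k ` V i \<subseteq> X" and W: "?W \<subseteq> X"
    using assms V_subset[of i] by auto
  have "\<phi> (inv k \<otimes> c \<otimes> k) ` V i = \<phi> (inv k \<otimes> c) ` \<phi> k ` V i"
    by (rule image_mult) (simp_all add: assms V_subset)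
  also have "\<dots> = \<phi> (inv k) ` ?W"
    by (rule image_mult) (simp_all add: assms kV)
  finally have eq: "\<phi> (inv k \<otimes> c \<otimes> k) ` V i = \<phi> (inv k) ` ?W" .
  have "\<phi> k ` \<phi> (inv k) ` ?W = ?W"
    using image_inv[OF W, of "inv k"] assms by simp
  then have "\<phi> (inv k) ` ?W = V i \<longleftrightarrow> ?W = \<phi> k ` V i"
    using image_inv[OF V_subset assms(2), of i] by metis
  moreover have "inv k \<otimes> c \<otimes> k \<in> carrier G" using assms by simp
  ultimately show ?thesis by (simp only: in_Gs_iff eq simp_thms)
qed

lemma in_C_iff_conjugates:
  "c \<in> C i \<longleftrightarrow> c \<in> carrier G \<and> (\<forall>k\<in>carrier G. inv k \<otimes> c \<otimes> k \<in> Gs i)"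
proof -
  have H: "Gs i \<subseteq> carrier G" using Gs_subgroup subgroup.subset by blast
  have "c \<in> C i \<longleftrightarrow> (\<forall>k\<in>carrier G. c \<in> k <# Gs i #> inv k)"
    by (simp only: normal_core_def INT_iff)
  also have "\<dots> \<longleftrightarrow> (\<forall>k\<in>carrier G. c \<in> carrier G \<and> inv k \<otimes> c \<otimes> k \<in> Gs i)"
    by (intro ball_cong refl) (rule in_conjugate_iff[OF _ H])
  \<comment> \<open>\<open>carrier G\<close> contains \<open>\<one>\<close>, so the condition on
    \<open>c\<close> alone can leave the quantifier.\<close>
  also have "\<dots> \<longleftrightarrow> c \<in> carrier G \<and> (\<forall>k\<in>carrier G. inv k \<otimes> c \<otimes> k \<in> Gs i)"
    using one_closed by (meson bspec ballI)
  finally show ?thesis .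
qed

lemma in_C_iff: "c \<in> C i \<longleftrightarrow> c \<in> carrier G \<and> (\<forall>A\<in>blocks i. \<phi> c ` A = A)"
proof -
  have "(\<forall>k\<in>carrier G. inv k \<otimes> c \<otimes> k \<in> Gs i) \<longleftrightarrow> (\<forall>A\<in>blocks i. \<phi> c ` A = A)"
    if "c \<in> carrier G"
  proof -
    have "(\<forall>k\<in>carrier G. inv k \<otimes> c \<otimes> k \<in> Gs i) \<longleftrightarrow>
        (\<forall>k\<in>carrier G. \<phi> c ` \<phi> k ` V i = \<phi> k ` V i)"
      by (intro ball_cong refl) (rule conjugate_in_Gs_iff[OF that])
    then show ?thesis unfolding blocks_def by blast
  qed
  then show ?thesis unfolding in_C_iff_conjugates by (simp only: cong: conj_cong)
qed

lemma in_C_D: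
  assumes "c \<in> C i"
  shows "c \<in> carrier G" and "A \<in> blocks i \<Longrightarrow> \<phi> c ` A = A"
  using assms[unfolded in_C_iff] by (rule conjunct1) (rule bspec[OF conjunct2[OF assms[unfolded in_C_iff]]])

lemma in_C_I:
  assumes "c \<in> carrier G" and "\<And>A. A \<in> blocks i \<Longrightarrow> \<phi> c ` A = A"
  shows "c \<in> C i"
  unfolding in_C_iff using assms by (intro conjI ballI)

lemma C_subset_Gs: "C i \<subseteq> Gs i"
proof
  fix c assume "c \<in> C i"
  then show "c \<in> Gs i" unfolding in_Gs_iff using in_C_D(1) in_C_D(2)[OF _ V_in_blocks] by blast
qed

lemma C_carrier: "C i \<subseteq> carrier G"
  using in_C_D(1) by (rule subsetI)

lemma C_subgroup: "subgroup (C i) G"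
proof (rule subgroupI)
  show "C i \<subseteq> carrier G" by (rule C_carrier)
  have "\<one> \<in> C i" by (intro in_C_I one_closed image_one blocks_subset)
  then show "C i \<noteq> {}" by (metis empty_iff)
next
  fix a assume a: "a \<in> C i"
  show "inv a \<in> C i"
  proof (rule in_C_I)
    show "inv a \<in> carrier G" using in_C_D(1)[OF a] by (rule inv_closed)
    fix A assume A: "A \<in> blocks i"
    show "\<phi> (inv a) ` A = A"
      using image_inv[OF blocks_subset[OF A] in_C_D(1)[OF a]] unfolding in_C_D(2)[OF a A] .
  qed
next
  fix a b assume a: "a \<in> C i" and b: "b \<in> C i"
  show "a \<otimes> b \<in> C i"
  proof (rule in_C_I)
    show "a \<otimes> b \<in> carrier G" using in_C_D(1)[OF a] in_C_D(1)[OF b] by (rule m_closed)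
    fix A assume A: "A \<in> blocks i"
    show "\<phi> (a \<otimes> b) ` A = A"
      using image_mult[OF blocks_subset[OF A] in_C_D(1)[OF a] in_C_D(1)[OF b]]
      unfolding in_C_D(2)[OF a A] in_C_D(2)[OF b A] .
  qed
qed

lemma C_antimono: "i \<le> j \<Longrightarrow> C j \<subseteq> C i"
  unfolding subset_iff in_C_iff_conjugates using Gs_antimono by blast

text \<open>\<open>C i\<close> is the kernel of an action on the finite set \<open>blocks i\<close>,
  so a coset is determined by one of finitely many self-maps of \<open>blocks i\<close>.\<close>

lemma C_cosets_finite: "finite ((\<lambda>g. C i #> g) ` carrier G)"
proof (rule finite_image_factor)
  \<comment> \<open>The inverse fits right cosets: those of \<open>a\<close> and \<open>b\<close>
    agree when \<open>b \<otimes> inv a\<close> fixes every block, that is, when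
    \<open>inv a\<close> and \<open>inv b\<close> permute the blocks alike.\<close>
  have "(\<lambda>g. \<lambda>A\<in>blocks i. \<phi> (inv g) ` A) ` carrier G \<subseteq> blocks i \<rightarrow>\<^sub>E blocks i"
    using image_blocks by auto
  moreover have "finite (blocks i \<rightarrow>\<^sub>E blocks i)"
    using blocks_finite by (simp add: blocks_def finite_PiE)
  ultimately show "finite ((\<lambda>g. \<lambda>A\<in>blocks i. \<phi> (inv g) ` A) ` carrier G)"
    by (rule finite_subset)
next
  fix a b assume a: "a \<in> carrier G" and b: "b \<in> carrier G"
    and eq: "(\<lambda>A\<in>blocks i. \<phi> (inv a) ` A) = (\<lambda>A\<in>blocks i. \<phi> (inv b) ` A)"
  have "\<phi> (b \<otimes> inv a) ` A = A" if A: "A \<in> blocks i" for A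
  proof -
    have "\<phi> (inv a) ` A = \<phi> (inv b) ` A" using eq A by (metis restrict_apply')
    then show ?thesis
      using image_mult[OF blocks_subset[OF A], of b "inv a"]
        image_inv[OF blocks_subset[OF A], of "inv b"] a b by simp
  qed
  then have "b \<otimes> inv a \<in> C i" using a b by (intro in_C_I m_closed inv_closed)
  then have "b \<in> C i #> a"
    using subgroup.rcos_module_rev[OF C_subgroup is_group a b] by simp
  then show "C i #> a = C i #> b" using repr_independence a C_subgroup by blast
qed

text \<open>\<open>C (Suc i)\<close> is absorbed by the larger subgroup \<open>C i\<close>. The
  bonding maps thus keep the representative of a coset.\<close>

lemma C_coset_extend:
  assumes "g \<in> carrier G"
  shows "C i <#> (C (Suc i) #> g) = C i #> g"
proof -
  have "C i <#> C (Suc i) = C i"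
  proof
    have "C i <#> C (Suc i) \<subseteq> C i <#> C i"
      by (intro mono_set_mult C_antimono order_refl) simp
    then show "C i <#> C (Suc i) \<subseteq> C i"
      unfolding subgroup_mult_id[OF C_subgroup] .
    have "C i <#> {\<one>} \<subseteq> C i <#> C (Suc i)"
      using subgroup.one_closed[OF C_subgroup] by (intro mono_set_mult order_refl) simp
    then show "C i \<subseteq> C i <#> C (Suc i)"
      unfolding r_coset_eq_set_mult[symmetric] coset_mult_one[OF C_carrier] .
  qed
  then show ?thesis
    unfolding setmult_rcos_assoc[OF C_carrier C_carrier assms] by (rule arg_cong)
qed

section \<open>Blocks and the metric on the compact space \<open>X\<close>\<close>

lemma compact_X: "compact X"
proof -
  have "compact_space (product_topology (\<lambda>_. discrete_topology (UNIV :: bool set)) (UNIV :: nat set))"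
    by (simp add: compact_space_product_topology compact_space_discrete_topology)
  then have "compact_space (top_of_set X)"
    using cantor homeomorphic_compact_space unfolding cantor_set_def by blast
  then show ?thesis by (simp add: compact_space_def compactin_subtopology)
qed

lemma same_block_X: "same_block i u v \<Longrightarrow> u \<in> X \<and> v \<in> X"
  unfolding same_block_def using blocks_subset by blast

lemma same_block_refl: "u \<in> X \<Longrightarrow> same_block i u u"
  unfolding same_block_def using blocks_cover by blast

lemma same_block_sym: "same_block i u v \<Longrightarrow> same_block i v u"
  unfolding same_block_def by blast

lemma same_block_trans: "same_block i u v \<Longrightarrow> same_block i v w \<Longrightarrow> same_block i u w"
  unfolding same_block_def using blocks_disjoint by blast

lemma same_block_antimono: "i \<le> j \<Longrightarrow> same_block j u v \<Longrightarrow> same_block i u v"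
  unfolding same_block_def blocks_def using V_decseq[THEN decseqD, of i j] by blast

lemma same_block_image:
  "g \<in> carrier G \<Longrightarrow> same_block i u v \<Longrightarrow> same_block i (\<phi> g u) (\<phi> g v)"
  unfolding same_block_def using image_blocks by blast

lemma same_block_dist:
  assumes "i \<ge> 1" "same_block i u v"
  shows "dist u v < 1 / 2 ^ i"
proof -
  obtain A where A: "A \<in> blocks i" "u \<in> A" "v \<in> A" using assms same_block_def by blast
  then obtain g where "g \<in> carrier G" "A = \<phi> g ` V i" unfolding blocks_def by blast
  then have "diameter A < 1 / 2 ^ i" using blocks_diameter[OF assms(1)] by simp
  \<comment> \<open>\<open>diameter\<close> bounds distances only on bounded sets.\<close>
  moreover have "bounded A"
    using bounded_subset[OF compact_imp_bounded[OF compact_X] blocks_subset[OF A(1)]] .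
  ultimately show ?thesis using diameter_bounded_bound[of A u v] A(2,3) by simp
qed

lemma ex_small_level:
  assumes "e > (0::real)"
  shows "\<exists>i\<ge>1. \<forall>u v. same_block i u v \<longrightarrow> dist u v < e"
proof -
  obtain n where n: "(1/2::real) ^ n < e"
    using real_arch_pow_inv[of e "1/2"] assms by auto
  \<comment> \<open>The level is \<open>Suc n\<close> because the diameter bound starts at level
    1.\<close>
  have "(1/2::real) ^ Suc n \<le> (1/2) ^ n" by simp
  then have "dist u v < e" if "same_block (Suc n) u v" for u v
    using same_block_dist[OF _ that] n by (simp add: power_divide)
  then show ?thesis by (intro exI[of _ "Suc n"]) auto
qed

lemma same_block_all_eq:
  assumes "\<And>i. same_block i u v" shows "u = v"
proof (rule ccontr)
  assume "u \<noteq> v"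
  then have "dist u v > 0" by simp
  then show False using ex_small_level[of "dist u v"] assms by auto
qed

lemma same_block_nbhd:
  assumes "u \<in> X"
  shows "\<exists>\<delta>>0. \<forall>v\<in>X. dist v u < \<delta> \<longrightarrow> same_block i u v"
proof -
  obtain A where A: "A \<in> blocks i" "u \<in> A" using blocks_cover assms by blast
  then obtain \<delta> where "\<delta> > 0" "\<forall>v\<in>X. dist v u < \<delta> \<longrightarrow> v \<in> A"
    using blocks_open[OF A(1)] unfolding openin_euclidean_subtopology_iff by blast
  then show ?thesis using A unfolding same_block_def by blast
qed

text \<open>Minimality enters here: a dense orbit enters the neighbourhood of \<open>w\<close> that
  lies in its block.\<close>

lemma orbit_meets_block:
  assumes "y \<in> X" "w \<in> X"
  shows "\<exists>g\<in>carrier G. same_block i (\<phi> g y) w"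
proof -
  obtain \<delta> where d: "\<delta> > 0" "\<forall>v\<in>X. dist v w < \<delta> \<longrightarrow> same_block i w v"
    using same_block_nbhd assms by blast
  have "w \<in> closure (orbit G \<phi> y)" using minimal assms by blast
  then obtain g where g: "g \<in> carrier G" "dist (\<phi> g y) w < \<delta>"
    using d(1) unfolding closure_approachable orbit_def by blast
  then have "same_block i w (\<phi> g y)" using d(2) assms(1) by simp
  then show ?thesis using g(1) same_block_sym by blast
qed

section \<open>Homogeneity forces a trivial discriminant group\<close>

lemma homogeneous_imp_eventually_in_C:
  assumes hom: "homogeneous_system G X \<phi>"
    and g: "\<And>j. g j \<in> Gs j"
  shows "\<exists>n. \<forall>j\<ge>n. g j \<in> C i"
proof -
  have gc: "g j \<in> carrier G" for j using g in_Gs_iff by blast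
  have "\<exists>n. \<forall>j\<ge>n. \<phi> (g j) ` A = A" if A: "A \<in> blocks i" for A
  proof -
    obtain k where k: "k \<in> carrier G" "A = \<phi> k ` V i" using A blocks_def by auto
    define p where "p = \<phi> k x"
    have p: "p \<in> A" "p \<in> X" using k x_in_V x_in_X by (auto simp: p_def)
    obtain h where h: "homeomorphic_map (top_of_set X) (top_of_set X) h" "h x = p"
      and comm: "\<And>a y. a \<in> carrier G \<Longrightarrow> y \<in> X \<Longrightarrow> h (\<phi> a y) = \<phi> a (h y)"
      using transitive_action.unique_orbit[OF hom[unfolded homogeneous_system_def] x_in_X p(2)]
      unfolding system_Aut_def by auto
    have cont: "continuous_on X h"
      using h(1) homeomorphic_imp_continuous_map by fastforce
    have hX: "h u \<in> X" if "u \<in> X" for u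
      using h(1) homeomorphic_imp_surjective_map that by fastforce
    obtain e where e: "e > 0" "\<And>v. v \<in> X \<Longrightarrow> dist v p < e \<Longrightarrow> same_block i p v"
      using same_block_nbhd[OF p(2)] by blast
    obtain d where d: "d > 0" "\<And>v. v \<in> X \<Longrightarrow> dist v x < d \<Longrightarrow> dist (h v) p < e"
      using cont e(1) x_in_X h(2) unfolding continuous_on_iff by blast
    obtain n where n: "\<And>u v. same_block n u v \<Longrightarrow> dist u v < d"
      using ex_small_level[OF d(1)] by blast
    have "\<phi> (g j) ` A = A" if "j \<ge> n" for j
    proof -
      have "\<phi> (g j) x \<in> V j" using g[of j] in_Gs_iff x_in_V by blast
      then have "same_block j (\<phi> (g j) x) x"
        using V_in_blocks x_in_V unfolding same_block_def by blast
      then have "dist (\<phi> (g j) x) x < d" using n same_block_antimono that by blast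
      then have "same_block i p (h (\<phi> (g j) x))" using d e hX gc x_in_X by simp
      \<comment> \<open>\<open>h\<close> commutes with the action and takes \<open>x\<close> to
        \<open>p\<close>. So \<open>g j\<close> keeps \<open>p\<close> in its block and, blocks
        being disjoint, fixes that block.\<close>
      then have "same_block i p (\<phi> (g j) p)" using comm gc x_in_X h(2) by simp
      then have "\<phi> (g j) p \<in> A" using A p blocks_disjoint unfolding same_block_def by blast
      then show ?thesis using A p image_blocks[OF gc A] blocks_disjoint by blast
    qed
    then show ?thesis by blast
  qed
  then obtain n where n: "\<And>A j. A \<in> blocks i \<Longrightarrow> j \<ge> n A \<Longrightarrow> \<phi> (g j) ` A = A" by metis
  \<comment> \<open>The threshold \<open>n A\<close> depends on the block; finiteness of
    \<open>blocks i\<close> allows one for all.\<close>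
  have "g j \<in> C i" if j: "j \<ge> Max (n ` blocks i)" for j
  proof -
    have "n A \<le> j" if "A \<in> blocks i" for A
      using j Max_ge[of "n ` blocks i" "n A"] that blocks_finite[of i, folded blocks_def]
      by (meson finite_imageI imageI order_trans)
    then show ?thesis using n that by (intro in_C_I gc) blast
  qed
  then show ?thesis by blast
qed

text \<open>Changing the carrier to \<open>Gs i\<close> keeps the multiplication, so the elements of
  the quotients are cosets taken in \<open>G\<close>.\<close>

lemma carrier_discriminant_group:
  "\<xi> \<in> carrier (discriminant_group G Gs) \<longleftrightarrow>
     (\<forall>i. \<xi> i \<in> (\<lambda>g. C i #> g) ` Gs i) \<and> (\<forall>i. C i <#> \<xi> (Suc i) = \<xi> i)"
  by (auto simp: discriminant_group_def inverse_limit_group_def carrier_FactGroup PiE_iff r_coset_def)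

text \<open>\<open>trivial_group\<close> also demands the group axioms; in the backward direction
  they are checked on the one-element carrier \<open>{C}\<close>.\<close>

lemma trivial_discriminant_group_iff:
  "trivial_group (discriminant_group G Gs) \<longleftrightarrow>
     (\<forall>\<xi>\<in>carrier (discriminant_group G Gs). \<forall>i. \<xi> i = C i)"
proof -
  have one: "\<one>\<^bsub>discriminant_group G Gs\<^esub> = C"
    by (auto simp: discriminant_group_def inverse_limit_group_def)
  have mult: "C \<otimes>\<^bsub>discriminant_group G Gs\<^esub> C = C"
    using subgroup_mult_id[OF C_subgroup]
    by (auto simp: discriminant_group_def inverse_limit_group_def set_mult_def)
  have "C i #> \<one> = C i" for i using C_carrier coset_mult_one by blast
  then have C: "C \<in> carrier (discriminant_group G Gs)"
    using C_coset_extend[OF one_closed] subgroup.one_closed[OF Gs_subgroup]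
    unfolding carrier_discriminant_group by (metis image_eqI)
  show ?thesis
  proof
    assume "trivial_group (discriminant_group G Gs)"
    then show "\<forall>\<xi>\<in>carrier (discriminant_group G Gs). \<forall>i. \<xi> i = C i"
      using one unfolding trivial_group_def by auto
  next
    assume R: "\<forall>\<xi>\<in>carrier (discriminant_group G Gs). \<forall>i. \<xi> i = C i"
    have "\<xi> = C" if "\<xi> \<in> carrier (discriminant_group G Gs)" for \<xi>
      using R that by (intro ext) blast
    then have "carrier (discriminant_group G Gs) = {C}" using C by blast
    moreover from this have "group (discriminant_group G Gs)"
      using one mult by (intro groupI) auto
    ultimately show "trivial_group (discriminant_group G Gs)"
      using one unfolding trivial_group_def by simp
  qed
qed

lemma homogeneous_imp_trivial:
  assumes "homogeneous_system G X \<phi>"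
  shows "trivial_group (discriminant_group G Gs)"
  unfolding trivial_discriminant_group_iff
proof (intro ballI allI)
  fix \<xi> i assume \<xi>: "\<xi> \<in> carrier (discriminant_group G Gs)"
  then obtain g where g: "\<And>j. g j \<in> Gs j" and \<xi>g: "\<And>j. \<xi> j = C j #> g j"
    unfolding carrier_discriminant_group image_iff by metis
  have gc: "g j \<in> carrier G" for j using g in_Gs_iff by blast
  \<comment> \<open>By compatibility with the bonding maps, representatives of later coordinates
    also represent coordinate \<open>i\<close>.\<close>
  have "\<xi> i = C i #> g j" if "j \<ge> i" for j
    using that
  proof (induction j rule: dec_induct)
    case base
    then show ?case by (rule \<xi>g)
  next
    case (step j)
    have "C j #> g j = C j #> g (Suc j)"
      using \<xi> \<xi>g C_coset_extend[OF gc] unfolding carrier_discriminant_group by metis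
    then have "g (Suc j) \<in> C j #> g j"
      using repr_independenceD[OF C_subgroup] gc by blast
    then have "g (Suc j) \<in> C i #> g j"
      using C_antimono[OF step.hyps(1)] unfolding r_coset_def by blast
    then show ?case using step.IH repr_independence[OF _ gc C_subgroup] by simp
  qed
  moreover obtain n where "\<And>j. j \<ge> n \<Longrightarrow> g j \<in> C i"
    using homogeneous_imp_eventually_in_C[OF assms g] by blast
  ultimately have "\<xi> i = C i #> g (max i n)" "g (max i n) \<in> C i" by auto
  then show "\<xi> i = C i" using coset_join2[OF gc C_subgroup] by simp
qed

section \<open>Chain groups contained in the cores\<close>

text \<open>
  Koenig's lemma: in the finitely branching tree of cosets of the \<open>C n\<close>, the cosets that contain
  infinitely many terms of a sequence \<open>g j \<in> Gs j\<close> avoiding \<open>C i\<close> carry an infinite branch, which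
  is a nontrivial element of the discriminant group.
\<close>

lemma trivial_imp_Gs_subset_C:
  assumes "trivial_group (discriminant_group G Gs)"
  shows "\<exists>j\<ge>i. Gs j \<subseteq> C i"
proof (rule ccontr)
  assume "\<not> ?thesis"
  then have "\<exists>g. \<forall>j\<ge>i. g j \<in> Gs j \<and> g j \<notin> C i"
    by (intro choice) blast
  then obtain g where g: "\<And>j. j \<ge> i \<Longrightarrow> g j \<in> Gs j \<and> g j \<notin> C i" by blast
  define J where "J n a = {j. j \<ge> i \<and> g j \<in> C n #> a}" for n a
  have gc: "g j \<in> carrier G" if "j \<ge> i" for j using g that in_Gs_iff by blast
  \<comment> \<open>There are finitely many cosets of \<open>C n\<close>, so one of them receives
    infinitely many indices of \<open>S\<close>.\<close>
  have pigeon: "\<exists>b\<in>carrier G. infinite (S \<inter> J n b)" if S: "infinite S" "S \<subseteq> {i..}" for S n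
  proof -
    have "finite ((\<lambda>j. C n #> g j) ` S)"
    proof (rule finite_subset[OF _ C_cosets_finite])
      show "(\<lambda>j. C n #> g j) ` S \<subseteq> (\<lambda>a. C n #> a) ` carrier G"
        using gc S(2) by (intro image_subsetI imageI) (simp add: subset_iff)
    qed
    then obtain k where k: "k \<in> S" "infinite {j \<in> S. C n #> g j = C n #> g k}"
      using pigeonhole_infinite[OF S(1), of "\<lambda>j. C n #> g j"] by auto
    have sub: "{j \<in> S. C n #> g j = C n #> g k} \<subseteq> S \<inter> J n (g k)"
      using S(2) rcos_self[OF gc C_subgroup] unfolding J_def by (auto simp: subset_iff)
    have "infinite (S \<inter> J n (g k))" using infinite_super[OF sub k(2)] .
    moreover have "g k \<in> carrier G" using k(1) S(2) gc by auto
    ultimately show ?thesis by (rule bexI)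
  qed
  \<comment> \<open>The branch: each coset keeps infinitely many indices, and the next coset lies
    inside it.\<close>
  have "\<exists>a. \<forall>n. (a n \<in> carrier G \<and> infinite (J n (a n))) \<and> a (Suc n) \<in> C n #> a n"
  proof (rule dependent_nat_choice)
    have "infinite {i..}" by (rule infinite_Ici)
    then show "\<exists>a. a \<in> carrier G \<and> infinite (J 0 a)"
      using pigeon[of "{i..}" 0] by (metis finite_Int order_refl)
  next
    fix a n assume a: "a \<in> carrier G \<and> infinite (J n a)"
    moreover have "J n a \<subseteq> {i..}" by (auto simp: J_def)
    ultimately obtain b where b: "b \<in> carrier G" "infinite (J n a \<inter> J (Suc n) b)"
      using pigeon by blast
    then obtain j where j: "j \<in> J n a" "j \<in> J (Suc n) b"
      by (metis IntE finite.emptyI equals0I)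
    \<comment> \<open>The common index \<open>j\<close> links the cosets: \<open>a\<close>,
      \<open>b\<close> and \<open>g j\<close> represent the same coset of
      \<open>C n\<close>.\<close>
    have "g j \<in> C n #> b"
      using j(2) C_antimono[of n "Suc n"] unfolding J_def r_coset_def by auto
    then have "C n #> b = C n #> g j" by (rule repr_independence[OF _ b(1) C_subgroup])
    moreover have "C n #> a = C n #> g j"
      using j(1) a by (intro repr_independence[OF _ _ C_subgroup]) (simp_all add: J_def)
    ultimately have "C n #> b = C n #> a" by simp
    then have "b \<in> C n #> a" using rcos_self[OF b(1) C_subgroup] by metis
    then show "\<exists>b. (b \<in> carrier G \<and> infinite (J (Suc n) b)) \<and> b \<in> C n #> a"
      using b by (metis finite_Int)
  qed
  then obtain a where ac: "\<And>n. a n \<in> carrier G" and aJ: "\<And>n. infinite (J n (a n))"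
    and aS: "\<And>n. a (Suc n) \<in> C n #> a n" by blast
  have "a n \<in> Gs n" for n
  proof -
    \<comment> \<open>An infinite index set has some \<open>j \<ge> n\<close>, for which
      \<open>g j\<close> lies in \<open>Gs n\<close>; \<open>a n\<close> differs from it by an
      element of \<open>C n\<close>.\<close>
    obtain j where j: "j \<in> J n (a n)" "j \<ge> n"
      using aJ[of n] unfolding infinite_nat_iff_unbounded_le by blast
    then have "g j \<in> Gs n" using g Gs_antimono unfolding J_def by blast
    have "C n #> a n = C n #> g j"
      using j(1) ac by (intro repr_independence[OF _ _ C_subgroup]) (simp_all add: J_def)
    then have "a n \<in> C n #> g j" using rcos_self[OF ac C_subgroup] by metis
    then obtain h where h: "h \<in> C n" "a n = h \<otimes> g j" unfolding r_coset_def by blast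
    have "h \<in> Gs n" using C_subset_Gs h(1) by (rule subsetD)
    then show ?thesis
      unfolding h(2) using \<open>g j \<in> Gs n\<close> by (rule subgroup.m_closed[OF Gs_subgroup])
  qed
  moreover have "C n <#> (C (Suc n) #> a (Suc n)) = C n #> a n" for n
    unfolding C_coset_extend[OF ac] by (rule repr_independence[OF aS ac C_subgroup, symmetric])
  ultimately have "(\<lambda>n. C n #> a n) \<in> carrier (discriminant_group G Gs)"
    unfolding carrier_discriminant_group by (intro conjI allI imageI)
  then have "C i #> a i = C i"
    using bspec[OF assms[unfolded trivial_discriminant_group_iff]] by meson
  \<comment> \<open>A term on the branch would lie in \<open>C i\<close>, against the choice of
    \<open>g\<close>.\<close>
  moreover obtain j where "j \<in> J i (a i)" using aJ[of i] by (metis finite.emptyI equals0I)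
  ultimately show False using g unfolding J_def by auto
qed

text \<open>The element \<open>inv g \<otimes> g'\<close> fixes the block of \<open>y\<close> at
  level \<open>j\<close>, so a conjugate of it lies in \<open>Gs j\<close>, hence in
  \<open>C i\<close>. As the core is normal, the element fixes all blocks at level \<open>i\<close>,
  including that of \<open>z\<close>.\<close>

lemma same_block_orbit:
  assumes sub: "Gs j \<subseteq> C i"
    and X: "y \<in> X" "z \<in> X" and g: "g \<in> carrier G" "g' \<in> carrier G"
    and same: "same_block j (\<phi> g y) (\<phi> g' y)"
  shows "same_block i (\<phi> g z) (\<phi> g' z)"
proof -
  define c where "c = inv g \<otimes> g'"
  have c: "c \<in> carrier G" using g by (simp add: c_def)
  have gc: "\<phi> g' u = \<phi> g (\<phi> c u)" if "u \<in> X" for u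
    using composition_rule[OF that g(1) c] g m_assoc[of g "inv g" g'] by (simp add: c_def)
  have "same_block j y (\<phi> c y)"
    using same_block_image[OF inv_closed[OF g(1)] same] phi_inv g X gc c by simp
  then obtain A where A: "A \<in> blocks j" "y \<in> A" "\<phi> c y \<in> A" unfolding same_block_def by blast
  then have cA: "\<phi> c ` A = A" using image_blocks[OF c A(1)] blocks_disjoint by blast
  obtain k where k: "k \<in> carrier G" "A = \<phi> k ` V j" using A blocks_def by auto
  then have conj: "inv k \<otimes> c \<otimes> k \<in> C i" using cA conjugate_in_Gs_iff[OF c k(1), of j] sub by auto
  \<comment> \<open>Normality of the core by hand: the conjugate of \<open>c\<close> fixes the image
    of \<open>B\<close> under \<open>inv k\<close>.\<close>
  have "\<phi> c ` B = B" if B: "B \<in> blocks i" for B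
  proof -
    have BX: "B \<subseteq> X" and B': "\<phi> (inv k) ` B \<in> blocks i" using B blocks_subset image_blocks k by auto
    have "\<phi> (inv k \<otimes> c) ` B = \<phi> (inv k \<otimes> c \<otimes> k) ` \<phi> (inv k) ` B"
      using image_mult[OF BX, of "inv k \<otimes> c \<otimes> k" "inv k"] k c by (simp add: m_assoc)
    also have "\<dots> = \<phi> (inv k) ` B" by (rule in_C_D(2)[OF conj B'])
    finally have "\<phi> k ` \<phi> (inv k) ` \<phi> c ` B = \<phi> k ` \<phi> (inv k) ` B"
      using image_mult[OF BX] k c by simp
    moreover have "\<phi> c ` B \<subseteq> X" using blocks_subset image_blocks[OF c B] by blast
    ultimately show ?thesis
      using image_inv[OF BX, of "inv k"] image_inv[of "\<phi> c ` B" "inv k"] k by simp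
  qed
  moreover obtain B where "B \<in> blocks i" "z \<in> B" using blocks_cover X by blast
  ultimately have "same_block i z (\<phi> c z)" unfolding same_block_def by blast
  then show ?thesis using same_block_image[OF g(1)] gc X by simp
qed

section \<open>Automorphisms from closures of orbit graphs\<close>

text \<open>
  \<open>orbit_graph y z\<close> is the closure of the set of all pairs \<open>(\<phi> g y, \<phi> g z)\<close> in \<open>X \<times> X\<close>.
\<close>

definition orbit_graph :: "'a \<Rightarrow> 'a \<Rightarrow> 'a \<Rightarrow> 'a \<Rightarrow> bool" where
  "orbit_graph y z w v \<longleftrightarrow>
     (\<forall>i. \<exists>g\<in>carrier G. same_block i (\<phi> g y) w \<and> same_block i (\<phi> g z) v)"

lemma orbit_graph_sym: "orbit_graph y z w v \<longleftrightarrow> orbit_graph z y v w"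
  unfolding orbit_graph_def by blast

lemma orbit_graph_X: "orbit_graph y z w v \<Longrightarrow> w \<in> X \<and> v \<in> X"
  unfolding orbit_graph_def using same_block_X by blast

lemma orbit_graph_base: "y \<in> X \<Longrightarrow> z \<in> X \<Longrightarrow> orbit_graph y z y z"
  unfolding orbit_graph_def using phi_one same_block_refl by (metis one_closed)

lemma orbit_graph_equivariant:
  assumes "orbit_graph y z w v" "k \<in> carrier G" "y \<in> X" "z \<in> X"
  shows "orbit_graph y z (\<phi> k w) (\<phi> k v)"
  unfolding orbit_graph_def
proof
  fix i
  obtain g where "g \<in> carrier G" "same_block i (\<phi> g y) w" "same_block i (\<phi> g z) v"
    using assms(1) orbit_graph_def by blast
  then show "\<exists>g\<in>carrier G. same_block i (\<phi> g y) (\<phi> k w) \<and> same_block i (\<phi> g z) (\<phi> k v)"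
    using same_block_image[OF assms(2)] composition_rule assms
    by (intro bexI[of _ "k \<otimes> g"]) auto
qed

text \<open>Compactness: if the \<open>g n\<close> take \<open>y\<close> ever closer to
  \<open>w\<close>, a limit point of the images of \<open>z\<close> serves as
  \<open>v\<close>.\<close>

lemma orbit_graph_total:
  assumes "y \<in> X" "z \<in> X" "w \<in> X"
  shows "\<exists>v. orbit_graph y z w v"
proof -
  obtain g where g: "\<And>n. g n \<in> carrier G" "\<And>n. same_block n (\<phi> (g n) y) w"
    using orbit_meets_block[OF assms(1,3)] by metis
  have "\<forall>n. \<phi> (g n) z \<in> X" using g(1) assms(2) by simp
  then obtain v r where v: "v \<in> X" and r: "strict_mono r"
    and lim: "((\<lambda>n. \<phi> (g n) z) \<circ> r) \<longlonglongrightarrow> v"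
    using compact_X unfolding compact_def by meson
  have "\<exists>a\<in>carrier G. same_block i (\<phi> a y) w \<and> same_block i (\<phi> a z) v" for i
  proof -
    obtain d where d: "d > 0" "\<And>u. u \<in> X \<Longrightarrow> dist u v < d \<Longrightarrow> same_block i v u"
      using same_block_nbhd[OF v] by blast
    obtain N where N: "\<And>n. n \<ge> N \<Longrightarrow> dist (\<phi> (g (r n)) z) v < d"
      using lim d(1) unfolding lim_sequentially comp_def by blast
    \<comment> \<open>\<open>N\<close> controls the images of \<open>z\<close>; the bound
      \<open>i\<close> ensures \<open>i \<le> r ?n\<close>, which controls those of
      \<open>y\<close>.\<close>
    let ?n = "max N i"
    have "same_block i (\<phi> (g (r ?n)) z) v"
      using d(2) N[of ?n] same_block_sym g(1) assms(2) by simp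
    moreover have "i \<le> r ?n" using seq_suble[OF r, of ?n] by simp
    then have "same_block i (\<phi> (g (r ?n)) y) w" using g(2) same_block_antimono by blast
    ultimately show ?thesis using g(1) by blast
  qed
  then show ?thesis unfolding orbit_graph_def by blast
qed

text \<open>Elements approximating the two pairs at level \<open>j\<close> take \<open>y\<close>
  into one block of that level, so \<open>same_block_orbit\<close> applies. As \<open>j\<close>
  depends on \<open>i\<close> only, this is uniform continuity; for \<open>w = w'\<close> it yields
  uniqueness.\<close>

lemma orbit_graph_continuous:
  assumes "Gs j \<subseteq> C i" "i \<le> j" "y \<in> X" "z \<in> X"
    and "orbit_graph y z w v" "orbit_graph y z w' v'" "same_block j w w'"
  shows "same_block i v v'"
proof -
  obtain g where g: "g \<in> carrier G" "same_block j (\<phi> g y) w" "same_block j (\<phi> g z) v"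
    using assms(5) orbit_graph_def by blast
  obtain g' where g': "g' \<in> carrier G" "same_block j (\<phi> g' y) w'" "same_block j (\<phi> g' z) v'"
    using assms(6) orbit_graph_def by blast
  have "same_block j (\<phi> g y) (\<phi> g' y)"
    using g g' assms(7) same_block_trans same_block_sym by blast
  then have "same_block i (\<phi> g z) (\<phi> g' z)"
    by (rule same_block_orbit[OF assms(1,3,4) g(1) g'(1)])
  then have "same_block i v (\<phi> g' z)"
    by (rule same_block_trans[OF same_block_sym[OF same_block_antimono[OF assms(2) g(3)]]])
  then show ?thesis
    by (rule same_block_trans[OF _ same_block_antimono[OF assms(2) g'(3)]])
qed

text \<open>Restricted to \<open>X\<close> because members of \<open>Bij X\<close> are
  \<open>undefined\<close> elsewhere.\<close>

definition orbit_map :: "'a \<Rightarrow> 'a \<Rightarrow> 'a \<Rightarrow> 'a" where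
  "orbit_map y z = (\<lambda>w\<in>X. SOME v. orbit_graph y z w v)"

text \<open>The assumption is what \<open>trivial_imp_Gs_subset_C\<close> provides from a trivial
  discriminant group.\<close>

context
  assumes Gs_subset_C: "\<And>i. \<exists>j\<ge>i. Gs j \<subseteq> C i"
begin

lemma orbit_graph_unique:
  assumes "y \<in> X" "z \<in> X" "orbit_graph y z w v" "orbit_graph y z w v'"
  shows "v = v'"
proof (rule same_block_all_eq)
  fix i
  obtain j where "j \<ge> i" "Gs j \<subseteq> C i" using Gs_subset_C by blast
  then show "same_block i v v'"
    using orbit_graph_continuous assms same_block_refl orbit_graph_X by blast
qed

lemma orbit_graph_iff:
  assumes "y \<in> X" "z \<in> X"
  shows "orbit_graph y z w v \<longleftrightarrow> w \<in> X \<and> orbit_map y z w = v"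
proof -
  have "orbit_graph y z w (orbit_map y z w)" if "w \<in> X"
    using orbit_graph_total[OF assms that] that unfolding orbit_map_def
    by (simp add: someI_ex)
  then show ?thesis using orbit_graph_unique[OF assms] orbit_graph_X by blast
qed

lemma continuous_map_orbit_map:
  assumes X: "y \<in> X" "z \<in> X"
  shows "continuous_map (top_of_set X) (top_of_set X) (orbit_map y z)"
proof -
  have graph: "orbit_graph y z w (orbit_map y z w)" if "w \<in> X" for w
    using orbit_graph_iff[OF X] that by blast
  have "continuous_on X (orbit_map y z)"
    unfolding continuous_on_iff
  proof (intro ballI allI impI)
    fix w and e :: real assume w: "w \<in> X" and "e > 0"
    then obtain i where i: "\<And>u v. same_block i u v \<Longrightarrow> dist u v < e"
      using ex_small_level by blast
    obtain j where j: "j \<ge> i" "Gs j \<subseteq> C i" using Gs_subset_C by blast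
    obtain d where d: "d > 0" "\<And>v. v \<in> X \<Longrightarrow> dist v w < d \<Longrightarrow> same_block j w v"
      using same_block_nbhd[OF w] by blast
    have "dist (orbit_map y z v) (orbit_map y z w) < e" if "v \<in> X" "dist v w < d" for v
      using i orbit_graph_continuous[OF j(2,1) X graph graph same_block_sym] d w that by blast
    then show "\<exists>d>0. \<forall>v\<in>X. dist v w < d \<longrightarrow> dist (orbit_map y z v) (orbit_map y z w) < e"
      using d(1) by blast
  qed
  moreover have "orbit_map y z w \<in> X" if "w \<in> X" for w
    using orbit_graph_X[OF graph[OF that]] by (rule conjunct2)
  ultimately show ?thesis by (auto simp: Pi_iff)
qed

text \<open>Swapping \<open>y\<close> and \<open>z\<close> transposes the graph.\<close>

lemma orbit_map_inverse:
  assumes "y \<in> X" "z \<in> X" "w \<in> X"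
  shows "orbit_map z y (orbit_map y z w) = w"
  using assms orbit_graph_iff orbit_graph_sym by blast

lemma orbit_map_in_Aut:
  assumes X: "y \<in> X" "z \<in> X"
  shows "orbit_map y z \<in> carrier (system_Aut G X \<phi>)"
proof -
  have maps: "homeomorphic_maps (top_of_set X) (top_of_set X) (orbit_map y z) (orbit_map z y)"
    using continuous_map_orbit_map orbit_map_inverse X by (simp add: homeomorphic_maps_def)
  then have homeo': "homeomorphic_map (top_of_set X) (top_of_set X) (orbit_map y z)"
    using homeomorphic_map_maps by blast
  then have "bij_betw (orbit_map y z) X X"
    by (metis bij_betw_def homeomorphic_imp_injective_map homeomorphic_imp_surjective_map
        topspace_euclidean_subtopology)
  then have "orbit_map y z \<in> Bij X" by (simp add: Bij_def orbit_map_def)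
  \<comment> \<open>The graph is \<open>G\<close>-invariant, so both sides are partners of the same
    point, and partners are unique.\<close>
  moreover have "orbit_map y z (\<phi> g w) = \<phi> g (orbit_map y z w)" if "g \<in> carrier G" "w \<in> X" for g w
    using orbit_graph_equivariant[OF _ that(1) X] orbit_graph_iff[OF X] that(2) by blast
  ultimately show ?thesis using homeo' by (simp add: system_Aut_def)
qed

lemma homogeneous: "homogeneous_system G X \<phi>"
  unfolding homogeneous_system_def
proof (intro transitive_action.intro transitive_action_axioms.intro)
  show "group_action (system_Aut G X \<phi>) X (\<lambda>h. h)"
    by (intro group_action_system_Aut group_action_axioms)
  fix y z assume X: "y \<in> X" "z \<in> X"
  then have "orbit_map y z y = z" using orbit_graph_base orbit_graph_iff by simp
  then show "\<exists>h\<in>carrier (system_Aut G X \<phi>). h y = z"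
    using orbit_map_in_Aut[OF X] by (rule bexI)
qed

end

end

theorem corollary1p11:
  fixes G :: "('g, 'c) monoid_scheme"
    and X :: "'a::metric_space set"
    and \<phi> :: "'g \<Rightarrow> 'a \<Rightarrow> 'a"
    and x :: 'a
    and Gs :: "nat \<Rightarrow> 'g set"
  assumes "equicontinuous_cantor_minimal_system G X \<phi>"
    and "x \<in> X"
    and "associated_group_chain G X \<phi> x Gs"
  shows "homogeneous_system G X \<phi> \<longleftrightarrow> trivial_group (discriminant_group G Gs)"
proof -
  obtain V where "group_chain G Gs" "decseq V" "(\<Inter>i. V i) = {x}"
    "\<forall>i. openin (top_of_set X) (V i) \<and> closedin (top_of_set X) (V i)"
    "\<forall>i. finite {\<phi> g ` V i | g. g \<in> carrier G} \<and>
         partition_on X {\<phi> g ` V i | g. g \<in> carrier G}"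
    "\<forall>i\<ge>1. \<forall>g\<in>carrier G. diameter (\<phi> g ` V i) < 1 / 2 ^ i"
    "\<forall>i. Gs i = {g \<in> carrier G. \<phi> g ` V i = V i}"
    using assms(3) unfolding associated_group_chain_def by (elim conjE exE) (rule that)
  then have "associated_chain G X \<phi> x Gs V"
    by (intro associated_chain.intro assms(1) associated_chain_axioms.intro) simp_all
  then interpret associated_chain G X \<phi> x Gs V .
  show ?thesis
    using homogeneous_imp_trivial trivial_imp_Gs_subset_C homogeneous by blast
qed

end
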